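(* Let $\mathcal{M}_1=(E,\mathcal{I}_1)$ be a matroid of rank $r$, let $\mathcal{X}_1\neq\emptyset$ be its set of bases, and let an assignment $o:E\to\mathcal{C}=\{\eta_1,\dots,\eta_K\}$ of ordered categories be given, with associated objective functions $o$, $c^{\min}$ and $c^{\max}$ on $\mathcal{X}_1$. Then the problems (MPO), (MPCmin) and (MPCmax) have the same efficient set, i.e. for every $B\in\mathcal{X}_1$, $B$ is efficient for (MPO) if and only if $B$ is efficient for (MPCmin) if and only if $B$ is efficient for (MPCmax). Moreover, the non-dominated set of each of the three problems has cardinality one.
   Context: Matroid: a pair $(E,\mathcal{I})$, $E$ a finite set, satisfying the usual independence axioms; bases are the inclusion-wise maximal independent sets, all of cardinality $r$ (the rank). Ordinal setting: $\mathcal{C}=\{\eta_1,\dots,\eta_K\}$ is a set of $K$ categories, totally ordered by $\eta_i\prec\eta_j$ iff $i<j$ ($\eta_i$ is strictly preferred over $\eta_j$), and $\eta_i\preceq\eta_j$ iff $i\le j$. A function $o:E\to\mathcal{C}$ assigns a category to each element. For a basis $B=\{e_1,\dots,e_r\}$, $o(B)=(o_1(B),\dots,o_r(B))\in\mathcal{C}^r$ denotes the vector of the categories $o(e_1),\dots,o(e_r)$ sorted in non-decreasing order. For bases $B_1,B_2$, $o(B_1)$ ordinally dominates $o(B_2)$, written $o(B_1)\preccurlyeq o(B_2)$, if $o_i(B_1)\preceq o_i(B_2)$ for all $i=1,\dots,r$ and $o(B_1)\ne o(B_2)$. Counting vectors: for $j=1,\dots,K$, $c_j(B)=|\{e\in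 B: o(e)=\eta_j\}|$, $c^{\max}_j(B)=c_j(B)$ and $c^{\min}_j(B)=c_{K-j+1}(B)$. Lexicographic order: for $y^1,y^2\in\mathbb{R}^K$, $y^1<_{\mathrm{lex}}y^2$ iff there is $k$ with $y^1_k<y^2_k$ and $y^1_i=y^2_i$ for all $i<k$. Problems (all over $B\in\mathcal{X}_1$): (MPO) minimizes $o(B)$ w.r.t. ordinal dominance: $\bar B$ is efficient if there is no $B\in\mathcal{X}_1$ with $o(B)\preccurlyeq o(\bar B)$. (MPCmin) lexicographically minimizes $c^{\min}(B)$: $\bar B$ is efficient if there is no $B\in\mathcal{X}_1$ with $c^{\min}(B)<_{\mathrm{lex}}c^{\min}(\bar B)$. (MPCmax) lexicographically maximizes $c^{\max}(B)$: $\bar B$ is efficient if there is no $B\in\mathcal{X}_1$ with $c^{\max}(\bar B)<_{\mathrm{lex}}c^{\max}(B)$. The efficient set is the set of all efficient bases; the non-dominated set is its image under the respective objective function ($o$, $c^{\min}$ or $c^{\max}$). *)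

theory Defs
  imports Complex_Main "HOL-Library.FuncSet" "HOL-Library.Multiset"
begin

locale matroid =
  fixes E :: "'a set" and \<I> :: "'a set set"
  assumes finite_ground: "finite E"
    and indep_subset_ground: "\<And>X. X \<in> \<I> \<Longrightarrow> X \<subseteq> E"
    and empty_indep: "{} \<in> \<I>"
    and indep_mono: "\<And>X Y. Y \<in> \<I> \<Longrightarrow> X \<subseteq> Y \<Longrightarrow> X \<in> \<I>"
    and augment: "\<And>X Y. X \<in> \<I> \<Longrightarrow> Y \<in> \<I> \<Longrightarrow> card X < card Y \<Longrightarrow> \<exists>y\<in>Y - X. insert y X \<in> \<I>"

definition bases :: "'a set set \<Rightarrow> 'a set set" where
  "bases \<I> = {B \<in> \<I>. \<forall>X\<in>\<I>. B \<subseteq> X \<longrightarrow> X = B}"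

definition matroid_rank :: "'a set set \<Rightarrow> nat" where
  "matroid_rank \<I> = (THE r. \<forall>B\<in>bases \<I>. card B = r)"

context matroid
begin

lemma card_bases_le:
  assumes "A \<in> bases \<I>" "B \<in> bases \<I>"
  shows "card B \<le> card A"
proof (rule ccontr)
  assume "\<not> card B \<le> card A"
  then obtain y where "y \<in> B - A" "insert y A \<in> \<I>"
    using augment[of A B] assms by (auto simp: bases_def)
  then show False using assms(1) by (auto simp: bases_def)
qed

lemma bases_nonempty: "bases \<I> \<noteq> {}"
proof -
  have "finite \<I>"
    using finite_ground indep_subset_ground by (meson Pow_iff finite_Pow_iff finite_subset subsetI)
  then obtain B where "B \<in> \<I>" "\<And>X. X \<in> \<I> \<Longrightarrow> B \<subseteq> X \<Longrightarrow> B = X"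
    using finite_has_maximal[of \<I>] empty_indep by blast
  then show ?thesis by (auto simp: bases_def)
qed

lemma card_basis:
  assumes "B \<in> bases \<I>"
  shows "card B = matroid_rank \<I>"
proof -
  have "\<forall>A\<in>bases \<I>. card A = card B"
    using card_bases_le[OF assms] card_bases_le[OF _ assms] by (simp add: le_antisym)
  then have "matroid_rank \<I> = card B"
    unfolding matroid_rank_def by (rule the_equality) (use assms in metis)+
  then show ?thesis by simp
qed

end

text \<open>
  The categories are \<open>\<eta> 1, \<dots>, \<eta> K\<close>, where \<open>\<eta>\<close> is strictly increasing on \<open>{1..K}\<close>; smaller
  categories are preferred. The assignment \<open>o\<close> is called \<open>cat\<close> here, since \<open>o\<close> is infix syntax.
\<close>

definition ordinal_vec :: "('a \<Rightarrow> 'c::linorder) \<Rightarrow> 'a set \<Rightarrow> 'c list" where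
  "ordinal_vec cat B = sorted_list_of_multiset (image_mset cat (mset_set B))"

definition ordinally_dominates :: "nat \<Rightarrow> 'c::linorder list \<Rightarrow> 'c list \<Rightarrow> bool" where
  "ordinally_dominates r u v \<longleftrightarrow> (\<forall>i<r. u ! i \<le> v ! i) \<and> u \<noteq> v"

text \<open>
  Vectors in \<open>\<real>\<^sup>K\<close> are functions on \<open>{1..K}\<close>, made extensional so that equality of vectors
  is equality of their \<open>K\<close> components.
\<close>

definition cat_count :: "(nat \<Rightarrow> 'c) \<Rightarrow> ('a \<Rightarrow> 'c) \<Rightarrow> 'a set \<Rightarrow> nat \<Rightarrow> nat" where
  "cat_count \<eta> cat B j = card {e \<in> B. cat e = \<eta> j}"

definition count_max :: "nat \<Rightarrow> (nat \<Rightarrow> 'c) \<Rightarrow> ('a \<Rightarrow> 'c) \<Rightarrow> 'a set \<Rightarrow> nat \<Rightarrow> real" where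
  "count_max K \<eta> cat B = (\<lambda>j\<in>{1..K}. real (cat_count \<eta> cat B j))"

definition count_min :: "nat \<Rightarrow> (nat \<Rightarrow> 'c) \<Rightarrow> ('a \<Rightarrow> 'c) \<Rightarrow> 'a set \<Rightarrow> nat \<Rightarrow> real" where
  "count_min K \<eta> cat B = (\<lambda>j\<in>{1..K}. real (cat_count \<eta> cat B (K - j + 1)))"

definition lex_less :: "nat \<Rightarrow> (nat \<Rightarrow> real) \<Rightarrow> (nat \<Rightarrow> real) \<Rightarrow> bool" where
  "lex_less K y z \<longleftrightarrow> (\<exists>k\<in>{1..K}. y k < z k \<and> (\<forall>i\<in>{1..<k}. y i = z i))"

definition efficient_set :: "'b set \<Rightarrow> ('b \<Rightarrow> 'v) \<Rightarrow> ('v \<Rightarrow> 'v \<Rightarrow> bool) \<Rightarrow> 'b set" where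
  "efficient_set X f better = {x \<in> X. \<not> (\<exists>x'\<in>X. better (f x') (f x))}"

definition MPO_efficient :: "'a set set \<Rightarrow> ('a \<Rightarrow> 'c::linorder) \<Rightarrow> 'a set set" where
  "MPO_efficient \<I> cat =
    efficient_set (bases \<I>) (ordinal_vec cat) (ordinally_dominates (matroid_rank \<I>))"

definition MPCmin_efficient ::
  "'a set set \<Rightarrow> nat \<Rightarrow> (nat \<Rightarrow> 'c) \<Rightarrow> ('a \<Rightarrow> 'c) \<Rightarrow> 'a set set" where
  "MPCmin_efficient \<I> K \<eta> cat =
    efficient_set (bases \<I>) (count_min K \<eta> cat) (lex_less K)"

definition MPCmax_efficient ::
  "'a set set \<Rightarrow> nat \<Rightarrow> (nat \<Rightarrow> 'c) \<Rightarrow> ('a \<Rightarrow> 'c) \<Rightarrow> 'a set set" where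
  "MPCmax_efficient \<I> K \<eta> cat =
    efficient_set (bases \<I>) (count_max K \<eta> cat) (\<lambda>y z. lex_less K z y)"

definition MPO_nondominated :: "'a set set \<Rightarrow> ('a \<Rightarrow> 'c::linorder) \<Rightarrow> 'c list set" where
  "MPO_nondominated \<I> cat = ordinal_vec cat ` MPO_efficient \<I> cat"

definition MPCmin_nondominated ::
  "'a set set \<Rightarrow> nat \<Rightarrow> (nat \<Rightarrow> 'c) \<Rightarrow> ('a \<Rightarrow> 'c) \<Rightarrow> (nat \<Rightarrow> real) set" where
  "MPCmin_nondominated \<I> K \<eta> cat = count_min K \<eta> cat ` MPCmin_efficient \<I> K \<eta> cat"

definition MPCmax_nondominated ::
  "'a set set \<Rightarrow> nat \<Rightarrow> (nat \<Rightarrow> 'c) \<Rightarrow> ('a \<Rightarrow> 'c) \<Rightarrow> (nat \<Rightarrow> real) set" where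
  "MPCmax_nondominated \<I> K \<eta> cat = count_max K \<eta> cat ` MPCmax_efficient \<I> K \<eta> cat"

end

theory Submission
  imports Defs
begin

text \<open>
  Compare bases by their cumulative counts, the numbers of elements of category at most \<open>x\<close>.
  If some basis \<open>B'\<close> beats \<open>B\<close> at a threshold \<open>x\<close>, then augmenting the part of \<open>B\<close> below \<open>x\<close> from
  \<open>B'\<close> and completing with elements of \<open>B\<close> exchanges one element of \<open>B\<close> for an element of
  better category, which improves the cumulative counts pointwise. Hence a basis whose cumulative
  counts are pointwise maximal is greatest at every threshold simultaneously. Ordinal dominance is
  the strict pointwise order of cumulative counts, and both lexicographic orders are compatible with
  it, so each of the three problems selects exactly the greatest bases.
\<close>

text \<open>Larger values are better, in contrast to \<open>ordinal_vec\<close>. The threshold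
  ranges over the whole linear order, so that the pointwise order on functions compares two bases at
  all thresholds.\<close>

definition cum_count :: "('a \<Rightarrow> 'c::linorder) \<Rightarrow> 'a set \<Rightarrow> 'c \<Rightarrow> nat" where
  "cum_count cat B x = card {e \<in> B. cat e \<le> x}"

section \<open>Basis exchange and the existence of a greatest basis\<close>

context matroid
begin

lemma finite_indep: "X \<in> \<I> \<Longrightarrow> finite X"
  using finite_ground indep_subset_ground finite_subset by blast

lemma basis_indep: "B \<in> bases \<I> \<Longrightarrow> B \<in> \<I>"
  by (simp add: bases_def)

lemma finite_basis: "B \<in> bases \<I> \<Longrightarrow> finite B"
  by (simp add: basis_indep finite_indep)

lemma finite_bases: "finite (bases \<I>)"
proof -
  have "bases \<I> \<subseteq> Pow E"
    using indep_subset_ground by (auto simp: bases_def)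
  then show ?thesis
    using finite_ground by (meson finite_Pow_iff finite_subset)
qed

text \<open>An independent proper superset of \<open>Z\<close> would have more elements than
  \<open>B\<close>, and augmenting \<open>B\<close> from it would contradict the maximality of
  \<open>B\<close>.\<close>

lemma basisI_card:
  assumes "Z \<in> \<I>" "B \<in> bases \<I>" "card B \<le> card Z"
  shows "Z \<in> bases \<I>"
  unfolding bases_def
proof (intro CollectI conjI ballI impI assms(1))
  fix X assume X: "X \<in> \<I>" "Z \<subseteq> X"
  show "X = Z"
  proof (rule ccontr)
    assume "X \<noteq> Z"
    then have "card Z < card X"
      using X finite_indep[OF X(1)] by (intro psubset_card_mono) auto
    then obtain y where "y \<in> X - B" "insert y B \<in> \<I>"
      using augment[of B X] X assms by (auto simp: bases_def)
    then show False
      using assms(2) by (auto simp: bases_def)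
  qed
qed

text \<open>A maximal independent set between \<open>W\<close> and \<open>W \<union> B\<close> is at
  least as large as \<open>B\<close>, since otherwise augmentation from \<open>B\<close> enlarges it
  within the same bounds. The upper bound keeps the new basis close to \<open>B\<close>.\<close>

lemma extend_to_basis:
  assumes "W \<in> \<I>" "B \<in> bases \<I>"
  obtains Z where "Z \<in> bases \<I>" "W \<subseteq> Z" "Z \<subseteq> W \<union> B"
proof -
  let ?F = "{Z \<in> \<I>. W \<subseteq> Z \<and> Z \<subseteq> W \<union> B}"
  have "finite (Pow (W \<union> B))"
    using assms finite_indep finite_basis by simp
  moreover have "?F \<subseteq> Pow (W \<union> B)"
    by auto
  ultimately have "finite ?F"
    by (rule rev_finite_subset)
  moreover have "W \<in> ?F"
    using assms by auto
  ultimately have "\<exists>Z\<in>?F. \<forall>X\<in>?F. Z \<subseteq> X \<longrightarrow> Z = X"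
    by (intro finite_has_maximal) auto
  then obtain Z where Z: "Z \<in> ?F" and max: "\<forall>X\<in>?F. Z \<subseteq> X \<longrightarrow> Z = X" ..
  have "card B \<le> card Z"
  proof (rule ccontr)
    assume "\<not> card B \<le> card Z"
    then obtain y where "y \<in> B - Z" "insert y Z \<in> \<I>"
      using augment[of Z B] Z basis_indep[OF assms(2)] by auto
    then show False
      using bspec[OF max, of "insert y Z"] Z by auto
  qed
  then have "Z \<in> bases \<I>"
    using basisI_card[OF _ assms(2)] Z by simp
  then show ?thesis
    using that Z by simp
qed

lemma improve_basis:
  assumes B: "B \<in> bases \<I>" and B': "B' \<in> bases \<I>"
    and less: "cum_count cat B x < cum_count cat B' x"
  obtains Z where "Z \<in> bases \<I>" "cum_count cat B < cum_count cat Z"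
proof -
  let ?X = "{e \<in> B. cat e \<le> x}" and ?Y = "{e \<in> B'. cat e \<le> x}"
  have "?X \<in> \<I>" "?Y \<in> \<I>"
    using basis_indep[OF B] basis_indep[OF B'] by (auto intro: indep_mono)
  then obtain y where y: "y \<in> ?Y - ?X" "insert y ?X \<in> \<I>"
    using augment[of ?X ?Y] less by (auto simp: cum_count_def)
  then have yB: "y \<notin> B" "cat y \<le> x"
    by auto
  obtain Z where Z: "Z \<in> bases \<I>" "insert y ?X \<subseteq> Z" "Z \<subseteq> insert y ?X \<union> B"
    using extend_to_basis[OF y(2) B] .
  have fin: "finite B" "finite Z"
    using B Z finite_basis by auto
  \<comment> \<open>\<open>Z\<close> and \<open>B\<close> have equal size and \<open>Z\<close>
    contains \<open>y\<close>, which lies outside \<open>B\<close>. So passing from \<open>B\<close>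
    to \<open>Z\<close> costs at most one element.\<close>
  have "Z - {y} \<subseteq> B"
    using Z by auto
  moreover have "card (Z - {y}) = card B - 1"
    using Z card_basis[OF B] card_basis[OF Z(1)] by simp
  ultimately have "card (B - (Z - {y})) \<le> 1"
    using fin by (simp add: card_Diff_subset)
  moreover have "B - (Z - {y}) = B - Z"
    using yB by auto
  ultimately have at_most_one: "card (B - Z) \<le> 1"
    by simp
  \<comment> \<open>For \<open>t \<le> x\<close> nothing counted is lost, because all of
    \<open>?X\<close> stays in \<open>Z\<close>. For larger \<open>t\<close> the new element
    \<open>y\<close> is counted and makes up for the one element that may be lost.\<close>
  have le: "cum_count cat B t \<le> cum_count cat Z t" for t
  proof (cases "t \<le> x")
    case True
    then have "{e \<in> B. cat e \<le> t} \<subseteq> {e \<in> Z. cat e \<le> t}"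
      using Z(2) by auto
    then show ?thesis
      unfolding cum_count_def using fin by (intro card_mono) auto
  next
    case False
    let ?T = "{e \<in> B. cat e \<le> t}"
    have "card ?T \<le> card (?T \<inter> Z) + card (B - Z)"
    proof -
      have "?T \<subseteq> (?T \<inter> Z) \<union> (B - Z)"
        by auto
      then have "card ?T \<le> card ((?T \<inter> Z) \<union> (B - Z))"
        using fin by (intro card_mono) auto
      then show ?thesis
        using card_Un_le order_trans by blast
    qed
    also have "\<dots> \<le> card (insert y (?T \<inter> Z))"
      using at_most_one fin yB by simp
    also have "\<dots> \<le> card {e \<in> Z. cat e \<le> t}"
      using fin Z(2) yB False by (intro card_mono) auto
    finally show ?thesis
      by (simp add: cum_count_def)
  qed
  \<comment> \<open>At \<open>x\<close> itself \<open>y\<close> is gained and nothing is lost, which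
    makes the improvement strict.\<close>
  have "card (insert y ?X) \<le> card {e \<in> Z. cat e \<le> x}"
    using fin Z(2) yB by (intro card_mono) auto
  then have "cum_count cat B x < cum_count cat Z x"
    using fin yB by (simp add: cum_count_def)
  then have "cum_count cat B < cum_count cat Z"
    using le by (auto simp: less_fun_def le_fun_def not_le)
  then show ?thesis
    using that Z(1) by blast
qed

text \<open>A basis exceeding \<open>B\<close> at a single threshold already yields one strictly
  above \<open>B\<close>, by \<open>improve_basis\<close>. Hence incomparable maximal bases cannot
  occur.\<close>

lemma greatest_basis_iff_maximal:
  assumes "B \<in> bases \<I>"
  shows "(\<forall>B'\<in>bases \<I>. cum_count cat B' \<le> cum_count cat B) \<longleftrightarrow>
    \<not> (\<exists>B'\<in>bases \<I>. cum_count cat B < cum_count cat B')"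
proof
  assume max: "\<not> (\<exists>B'\<in>bases \<I>. cum_count cat B < cum_count cat B')"
  show "\<forall>B'\<in>bases \<I>. cum_count cat B' \<le> cum_count cat B"
  proof (intro ballI le_funI, rule ccontr)
    fix B' x assume "B' \<in> bases \<I>" "\<not> cum_count cat B' x \<le> cum_count cat B x"
    then obtain Z where "Z \<in> bases \<I>" "cum_count cat B < cum_count cat Z"
      using improve_basis[OF assms, of B' cat x] by (auto simp: not_le)
    then show False
      using max by blast
  qed
next
  assume "\<forall>B'\<in>bases \<I>. cum_count cat B' \<le> cum_count cat B"
  then show "\<not> (\<exists>B'\<in>bases \<I>. cum_count cat B < cum_count cat B')"
    by (meson less_le_not_le)
qed

lemma greatest_basis_exists:
  obtains B where "B \<in> bases \<I>" "\<forall>B'\<in>bases \<I>. cum_count cat B' \<le> cum_count cat B"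
proof -
  have "finite (cum_count cat ` bases \<I>)" "cum_count cat ` bases \<I> \<noteq> {}"
    using finite_bases bases_nonempty by auto
  then have "\<exists>m\<in>cum_count cat ` bases \<I>. \<forall>c\<in>cum_count cat ` bases \<I>. m \<le> c \<longrightarrow> m = c"
    by (rule finite_has_maximal)
  then obtain m where m: "m \<in> cum_count cat ` bases \<I>"
    and max: "\<forall>c\<in>cum_count cat ` bases \<I>. m \<le> c \<longrightarrow> m = c" ..
  obtain B where B: "B \<in> bases \<I>" "m = cum_count cat B"
    using m by blast
  have "\<not> (\<exists>B'\<in>bases \<I>. cum_count cat B < cum_count cat B')"
    using max B(2) by (auto simp: less_le[of "cum_count cat B"])
  then show ?thesis
    using that[OF B(1)] greatest_basis_iff_maximal[OF B(1), of cat] by blast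
qed

text \<open>Common interface for the three problems. A better basis refutes that \<open>B\<close> is
  greatest, by the first assumption; conversely, if \<open>B\<close> is not greatest, it is not
  maximal either, and the second assumption makes the basis strictly above it a better one.\<close>

lemma efficient_set_eq_greatest:
  assumes "\<And>B B'. B \<in> bases \<I> \<Longrightarrow> B' \<in> bases \<I> \<Longrightarrow> better (f B') (f B) \<Longrightarrow>
      \<not> cum_count cat B' \<le> cum_count cat B"
    and "\<And>B B'. B \<in> bases \<I> \<Longrightarrow> B' \<in> bases \<I> \<Longrightarrow> cum_count cat B < cum_count cat B' \<Longrightarrow>
      better (f B') (f B)"
  shows "efficient_set (bases \<I>) f better =
    {B \<in> bases \<I>. \<forall>B'\<in>bases \<I>. cum_count cat B' \<le> cum_count cat B}"
proof -
  have "(\<exists>B'\<in>bases \<I>. better (f B') (f B)) \<longleftrightarrow>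
      \<not> (\<forall>B'\<in>bases \<I>. cum_count cat B' \<le> cum_count cat B)" if B: "B \<in> bases \<I>" for B
  proof
    assume "\<not> (\<forall>B'\<in>bases \<I>. cum_count cat B' \<le> cum_count cat B)"
    then obtain B' where "B' \<in> bases \<I>" "cum_count cat B < cum_count cat B'"
      using greatest_basis_iff_maximal[OF B, of cat] by auto
    then show "\<exists>B'\<in>bases \<I>. better (f B') (f B)"
      using assms(2)[OF B] by auto
  qed (use assms(1)[OF B] in auto)
  then show ?thesis
    unfolding efficient_set_def by auto
qed

text \<open>By antisymmetry all greatest bases share one cumulative count, so an objective
  determined by that count takes one value on them, and a greatest basis exists.\<close>

lemma card_image_greatest:
  assumes "\<And>B B'. B \<in> bases \<I> \<Longrightarrow> B' \<in> bases \<I> \<Longrightarrow> cum_count cat B = cum_count cat B' \<Longrightarrow>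
      f B = f B'"
  shows "card (f ` {B \<in> bases \<I>. \<forall>B'\<in>bases \<I>. cum_count cat B' \<le> cum_count cat B}) = 1"
proof -
  obtain B where B: "B \<in> bases \<I>" "\<forall>B'\<in>bases \<I>. cum_count cat B' \<le> cum_count cat B"
    by (rule greatest_basis_exists)
  have "f B' = f B" if "B' \<in> bases \<I>" "\<forall>B''\<in>bases \<I>. cum_count cat B'' \<le> cum_count cat B'" for B'
    by (rule assms[OF that(1) B(1)]) (use B that in \<open>simp add: antisym\<close>)
  then have "f ` {B \<in> bases \<I>. \<forall>B'\<in>bases \<I>. cum_count cat B' \<le> cum_count cat B} = {f B}"
    using B by blast
  then show ?thesis
    by simp
qed

end

section \<open>Sorted category vectors and ordinal dominance\<close>

lemma sorted_nth_le_iff: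
  assumes "sorted xs" "i < length xs"
  shows "xs ! i \<le> x \<longleftrightarrow> i < length (filter (\<lambda>y. y \<le> x) xs)"
  using assms
proof (induction xs arbitrary: i)
  case (Cons a xs)
  show ?case
  proof (cases "a \<le> x")
    case True
    then show ?thesis
      using Cons by (cases i) auto
  next
    case False
    \<comment> \<open>By sortedness, a head above \<open>x\<close> puts every entry above
      \<open>x\<close>.\<close>
    then have *: "\<not> y \<le> x" if "y \<in> set (a # xs)" for y
      using Cons.prems(1) that by (auto dest: order_trans)
    then have "filter (\<lambda>y. y \<le> x) (a # xs) = []"
      by (simp add: filter_empty_conv)
    moreover have "\<not> (a # xs) ! i \<le> x"
      using * nth_mem[OF Cons.prems(2)] by blast
    ultimately show ?thesis
      by simp
  qed
qed simp

text \<open>In a sorted list the entries at most \<open>x\<close> form an initial segment, so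
  positions and counts determine each other. The order is reversed: smaller entries mean larger
  counts.\<close>

lemma sorted_nth_mono_iff_filter:
  fixes xs ys :: "'c::linorder list"
  assumes "sorted xs" "sorted ys" "length xs = n" "length ys = n"
  shows "(\<forall>i<n. xs ! i \<le> ys ! i) \<longleftrightarrow>
    (\<forall>x. length (filter (\<lambda>y. y \<le> x) ys) \<le> length (filter (\<lambda>y. y \<le> x) xs))"
proof
  assume le: "\<forall>i<n. xs ! i \<le> ys ! i"
  show "\<forall>x. length (filter (\<lambda>y. y \<le> x) ys) \<le> length (filter (\<lambda>y. y \<le> x) xs)"
  proof (rule allI, rule ccontr)
    fix x
    \<comment> \<open>\<open>?i\<close> is the first position at which \<open>xs\<close> exceeds
      \<open>x\<close>, while \<open>ys\<close> is still at most \<open>x\<close> there.\<close>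
    let ?i = "length (filter (\<lambda>y. y \<le> x) xs)"
    assume *: "\<not> length (filter (\<lambda>y. y \<le> x) ys) \<le> ?i"
    then have "?i < n"
      using length_filter_le[of "\<lambda>y. y \<le> x" ys] assms(4) by linarith
    then have "ys ! ?i \<le> x" "\<not> xs ! ?i \<le> x"
      using * sorted_nth_le_iff[of xs ?i x] sorted_nth_le_iff[of ys ?i x] assms by auto
    then show False
      using le \<open>?i < n\<close> by (meson order_trans)
  qed
next
  assume le: "\<forall>x. length (filter (\<lambda>y. y \<le> x) ys) \<le> length (filter (\<lambda>y. y \<le> x) xs)"
  show "\<forall>i<n. xs ! i \<le> ys ! i"
  proof (intro allI impI)
    fix i assume "i < n"
    \<comment> \<open>The threshold \<open>ys ! i\<close> is reached by the entries of
      \<open>ys\<close> at positions \<open>0\<close> to \<open>i\<close>, hence by at least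
      \<open>i + 1\<close> of them.\<close>
    then have "i < length (filter (\<lambda>y. y \<le> ys ! i) ys)"
      using sorted_nth_le_iff[of ys i "ys ! i"] assms by simp
    also have "\<dots> \<le> length (filter (\<lambda>y. y \<le> ys ! i) xs)"
      using le by blast
    finally show "xs ! i \<le> ys ! i"
      using sorted_nth_le_iff[of xs i "ys ! i"] assms \<open>i < n\<close> by simp
  qed
qed

lemma sorted_ordinal_vec: "sorted (ordinal_vec cat B)"
  by (simp add: ordinal_vec_def)

lemma mset_ordinal_vec: "mset (ordinal_vec cat B) = image_mset cat (mset_set B)"
  by (simp add: ordinal_vec_def)

lemma length_ordinal_vec: "length (ordinal_vec cat B) = card B"
  using arg_cong[OF mset_ordinal_vec, of size cat B] by simp

lemma length_filter_ordinal_vec: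
  assumes "finite B"
  shows "length (filter (\<lambda>y. y \<le> x) (ordinal_vec cat B)) = cum_count cat B x"
proof -
  have "length (filter (\<lambda>y. y \<le> x) (ordinal_vec cat B)) =
      size (filter_mset (\<lambda>y. y \<le> x) (image_mset cat (mset_set B)))"
    by (simp only: mset_filter[symmetric] mset_ordinal_vec[symmetric] size_mset)
  also have "\<dots> = card {e \<in> B. cat e \<le> x}"
    using assms by (simp add: filter_mset_image_mset)
  finally show ?thesis
    by (simp add: cum_count_def)
qed

lemma ordinal_vec_le_iff:
  assumes "finite B" "finite B'" "card B = r" "card B' = r"
  shows "(\<forall>i<r. ordinal_vec cat B' ! i \<le> ordinal_vec cat B ! i) \<longleftrightarrow>
    cum_count cat B \<le> cum_count cat B'"
  unfolding le_fun_def length_filter_ordinal_vec[OF assms(1), symmetric]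
    length_filter_ordinal_vec[OF assms(2), symmetric]
  by (rule sorted_nth_mono_iff_filter) (simp_all add: sorted_ordinal_vec length_ordinal_vec assms)

text \<open>Equal counts give both componentwise inequalities by \<open>ordinal_vec_le_iff\<close>,
  and antisymmetry gives equal entries.\<close>

lemma ordinal_vec_eq_iff:
  assumes "finite B" "finite B'" "card B = r" "card B' = r"
  shows "ordinal_vec cat B = ordinal_vec cat B' \<longleftrightarrow> cum_count cat B = cum_count cat B'"
proof
  assume eq: "ordinal_vec cat B = ordinal_vec cat B'"
  show "cum_count cat B = cum_count cat B'"
    unfolding fun_eq_iff length_filter_ordinal_vec[OF assms(1), symmetric]
      length_filter_ordinal_vec[OF assms(2), symmetric] eq by (rule allI) (rule refl)
next
  assume eq: "cum_count cat B = cum_count cat B'"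
  show "ordinal_vec cat B = ordinal_vec cat B'"
  proof (rule nth_equalityI)
    show "length (ordinal_vec cat B) = length (ordinal_vec cat B')"
      by (simp add: length_ordinal_vec assms)
    fix i assume "i < length (ordinal_vec cat B)"
    then have "i < r"
      by (simp add: length_ordinal_vec assms)
    moreover have "\<forall>i<r. ordinal_vec cat B' ! i \<le> ordinal_vec cat B ! i"
      unfolding ordinal_vec_le_iff[OF assms] eq by (rule order_refl)
    moreover have "\<forall>i<r. ordinal_vec cat B ! i \<le> ordinal_vec cat B' ! i"
      unfolding ordinal_vec_le_iff[OF assms(2,1,4,3)] eq by (rule order_refl)
    ultimately show "ordinal_vec cat B ! i = ordinal_vec cat B' ! i"
      by (blast intro: antisym)
  qed
qed

lemma ordinally_dominates_iff:
  assumes "finite B" "finite B'" "card B = r" "card B' = r"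
  shows "ordinally_dominates r (ordinal_vec cat B') (ordinal_vec cat B) \<longleftrightarrow>
    cum_count cat B < cum_count cat B'"
  unfolding ordinally_dominates_def ordinal_vec_le_iff[OF assms] less_le[of "cum_count cat B"]
    ordinal_vec_eq_iff[OF assms(2,1,4,3)]
  by (simp only: eq_commute)

section \<open>Lexicographic comparison of counting vectors\<close>

lemma lex_less_total:
  assumes "y \<in> extensional {1..K}" "z \<in> extensional {1..K}" "y \<noteq> z"
  shows "lex_less K y z \<or> lex_less K z y"
proof -
  let ?P = "\<lambda>k. k \<in> {1..K} \<and> y k \<noteq> z k"
  \<comment> \<open>Extensional functions are determined on \<open>{1..K}\<close>, so distinct ones
    differ at an index in that range; the least such index decides the comparison.\<close>
  have "\<exists>k. ?P k"
    using assms extensionalityI[of y "{1..K}" z] by blast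
  then obtain k where "?P k" "\<forall>i<k. \<not> ?P i"
    using exists_least_iff[of ?P] by (simp only:) blast
  then have k: "k \<in> {1..K}" "y k \<noteq> z k" and least: "\<And>i. i < k \<Longrightarrow> \<not> ?P i"
    by blast+
  have eq: "\<forall>i\<in>{1..<k}. y i = z i"
    using k least by auto
  show ?thesis
  proof (cases "y k < z k")
    case True
    then show ?thesis
      unfolding lex_less_def using k eq by blast
  next
    case False
    then have "z k < y k" "\<forall>i\<in>{1..<k}. z i = y i"
      using k eq by auto
    then show ?thesis
      unfolding lex_less_def using k by blast
  qed
qed

lemma count_min_eq_iff_count_max:
  "count_min K \<eta> cat B = count_min K \<eta> cat B' \<longleftrightarrow> count_max K \<eta> cat B = count_max K \<eta> cat B'"
  (is "?min \<longleftrightarrow> ?max")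
proof
  assume min: ?min
  have "cat_count \<eta> cat B i = cat_count \<eta> cat B' i" if "i \<in> {1..K}" for i
    \<comment> \<open>The reversal of indices is an involution on \<open>{1..K}\<close>: entry
      \<open>K - i + 1\<close> of \<open>count_min\<close> is the count of category
      \<open>i\<close>.\<close>
    using that fun_cong[OF min, of "K - i + 1"] by (auto simp: count_min_def Suc_diff_le split: if_splits)
  then show ?max
    unfolding count_max_def by (intro restrict_ext) auto
next
  assume max: ?max
  have "cat_count \<eta> cat B i = cat_count \<eta> cat B' i" if "i \<in> {1..K}" for i
    using that fun_cong[OF max, of i] by (simp add: count_max_def)
  then show ?min
    unfolding count_min_def by (intro restrict_ext) auto
qed

section \<open>Counting vectors against cumulative counts\<close>

context
  fixes K :: nat and \<eta> :: "nat \<Rightarrow> 'c::linorder" and cat :: "'a \<Rightarrow> 'c"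
  assumes mono: "strict_mono_on {1..K} \<eta>"
begin

text \<open>The elements below the threshold split into category classes, which are disjoint because
  \<open>\<eta>\<close> is injective on \<open>{1..K}\<close>.\<close>

lemma cum_count_eq_sum:
  assumes "finite B" "cat ` B \<subseteq> \<eta> ` {1..K}"
  shows "cum_count cat B x = (\<Sum>i\<in>{i\<in>{1..K}. \<eta> i \<le> x}. cat_count \<eta> cat B i)"
proof -
  have inj: "inj_on \<eta> {1..K}"
    using mono by (rule strict_mono_on_imp_inj_on)
  have "{e \<in> B. cat e \<le> x} = (\<Union>i\<in>{i\<in>{1..K}. \<eta> i \<le> x}. {e \<in> B. cat e = \<eta> i})"
  proof (intro set_eqI iffI)
    fix e assume e: "e \<in> {e \<in> B. cat e \<le> x}"
    then obtain i where "i \<in> {1..K}" "cat e = \<eta> i"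
      using assms(2) by blast
    then show "e \<in> (\<Union>i\<in>{i\<in>{1..K}. \<eta> i \<le> x}. {e \<in> B. cat e = \<eta> i})"
      using e by auto
  qed auto
  also have "card \<dots> = (\<Sum>i\<in>{i\<in>{1..K}. \<eta> i \<le> x}. card {e \<in> B. cat e = \<eta> i})"
    using assms(1) inj by (intro card_UN_disjoint) (auto simp: inj_on_eq_iff[OF inj])
  finally show ?thesis
    by (simp add: cum_count_def cat_count_def)
qed

lemma cum_count_category:
  assumes "finite B" "cat ` B \<subseteq> \<eta> ` {1..K}" "k \<in> {1..K}"
  shows "cum_count cat B (\<eta> k) = (\<Sum>i\<in>{1..k}. cat_count \<eta> cat B i)"
proof -
  have "{i\<in>{1..K}. \<eta> i \<le> \<eta> k} = {1..k}"
    using assms(3) strict_mono_on_less_eq[OF mono] by auto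
  then show ?thesis
    using cum_count_eq_sum[OF assms(1,2)] by simp
qed

text \<open>The threshold \<open>\<eta> K\<close> captures all of \<open>B\<close>. For
  \<open>K = 0\<close> there are no categories and \<open>B\<close> is empty.\<close>

lemma card_eq_sum:
  assumes "finite B" "cat ` B \<subseteq> \<eta> ` {1..K}"
  shows "card B = (\<Sum>i\<in>{1..K}. cat_count \<eta> cat B i)"
proof (cases "K = 0")
  case False
  have "cat e \<le> \<eta> K" if "e \<in> B" for e
    using assms(2) that strict_mono_on_leD[OF mono] False by (auto simp: image_subset_iff image_iff)
  then have "{e \<in> B. cat e \<le> \<eta> K} = B"
    by auto
  then show ?thesis
    using cum_count_category[OF assms, of K] False by (simp add: cum_count_def)
qed (use assms in auto)

text \<open>Up to the first category where the counts differ, the prefix sum of \<open>B'\<close> is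
  strictly larger, so \<open>B'\<close> wins at that threshold.\<close>

lemma lex_less_count_max:
  assumes "finite B" "cat ` B \<subseteq> \<eta> ` {1..K}" "finite B'" "cat ` B' \<subseteq> \<eta> ` {1..K}"
    and "lex_less K (count_max K \<eta> cat B) (count_max K \<eta> cat B')"
  shows "\<not> cum_count cat B' \<le> cum_count cat B"
proof -
  obtain k where k: "k \<in> {1..K}" "cat_count \<eta> cat B k < cat_count \<eta> cat B' k"
    and eq: "\<And>i. i \<in> {1..<k} \<Longrightarrow> cat_count \<eta> cat B i = cat_count \<eta> cat B' i"
    using assms(5) by (auto simp: lex_less_def count_max_def)
  have "(\<Sum>i\<in>{1..k}. cat_count \<eta> cat B i) < (\<Sum>i\<in>{1..k}. cat_count \<eta> cat B' i)"
    using k eq by (intro sum_strict_mono_ex1) (auto simp: le_less)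
  then have "cum_count cat B (\<eta> k) < cum_count cat B' (\<eta> k)"
    using cum_count_category assms k by simp
  then show ?thesis
    by (auto simp: le_fun_def not_le)
qed

text \<open>Here the comparison starts at the worst category, so \<open>B'\<close> has the smaller
  suffix sum. Since both sets have the same size, \<open>B'\<close> has the larger prefix sum just
  before that suffix.\<close>

lemma lex_less_count_min:
  assumes "finite B" "cat ` B \<subseteq> \<eta> ` {1..K}" "finite B'" "cat ` B' \<subseteq> \<eta> ` {1..K}"
    and "card B = card B'"
    and "lex_less K (count_min K \<eta> cat B') (count_min K \<eta> cat B)"
  shows "\<not> cum_count cat B' \<le> cum_count cat B"
proof -
  let ?c = "cat_count \<eta> cat"
  obtain k where k: "k \<in> {1..K}" "?c B' (K - k + 1) < ?c B (K - k + 1)"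
    and eq: "\<And>i. i \<in> {1..<k} \<Longrightarrow> ?c B' (K - i + 1) = ?c B (K - i + 1)"
    using assms(6) by (auto simp: lex_less_def count_min_def)
  \<comment> \<open>The deciding category is \<open>K - k + 1 = Suc j\<close>, so the suffix starts
    at \<open>Suc j\<close> and the threshold to test is \<open>\<eta> j\<close>.\<close>
  define j where "j = K - k"
  have j: "j < K" "?c B' (Suc j) < ?c B (Suc j)"
    using k by (auto simp: j_def)
  have eq': "?c B' i = ?c B i" if "i \<in> {Suc (Suc j)..K}" for i
    using eq[of "K + 1 - i"] that k by (auto simp: j_def Suc_diff_le)
  have tail: "(\<Sum>i\<in>{Suc j..K}. ?c B' i) < (\<Sum>i\<in>{Suc j..K}. ?c B i)"
  proof (rule sum_strict_mono_ex1)
    show "\<forall>i\<in>{Suc j..K}. ?c B' i \<le> ?c B i"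
      using j eq' by (metis Suc_leI atLeastAtMost_iff le_neq_implies_less less_imp_le order_refl)
  qed (use j in auto)
  have split: "card A = (\<Sum>i\<in>{1..j}. ?c A i) + (\<Sum>i\<in>{Suc j..K}. ?c A i)"
    if "finite A" "cat ` A \<subseteq> \<eta> ` {1..K}" for A
  proof -
    have "{1..K} = {1..j} \<union> {Suc j..K}"
      using j by auto
    then show ?thesis
      using card_eq_sum[OF that] by (simp add: sum.union_disjoint)
  qed
  have head: "(\<Sum>i\<in>{1..j}. ?c B i) < (\<Sum>i\<in>{1..j}. ?c B' i)"
    using split[OF assms(1,2)] split[OF assms(3,4)] assms(5) tail by linarith
  \<comment> \<open>For \<open>j = 0\<close> both prefix sums would be empty, contradicting the
    strict inequality.\<close>
  then have "j \<in> {1..K}"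
    using j by (cases j) auto
  then have "cum_count cat B (\<eta> j) < cum_count cat B' (\<eta> j)"
    using head cum_count_category assms by simp
  then show ?thesis
    by (auto simp: le_fun_def not_le)
qed

lemma cum_count_eqI:
  assumes "finite B" "cat ` B \<subseteq> \<eta> ` {1..K}" "finite B'" "cat ` B' \<subseteq> \<eta> ` {1..K}"
    and "\<And>i. i \<in> {1..K} \<Longrightarrow> cat_count \<eta> cat B i = cat_count \<eta> cat B' i"
  shows "cum_count cat B = cum_count cat B'"
  using cum_count_eq_sum assms by (auto intro!: ext sum.cong)

lemma count_max_eq_iff:
  assumes "finite B" "cat ` B \<subseteq> \<eta> ` {1..K}" "finite B'" "cat ` B' \<subseteq> \<eta> ` {1..K}"
  shows "count_max K \<eta> cat B = count_max K \<eta> cat B' \<longleftrightarrow> cum_count cat B = cum_count cat B'"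
proof
  assume eq: "count_max K \<eta> cat B = count_max K \<eta> cat B'"
  have "cat_count \<eta> cat B i = cat_count \<eta> cat B' i" if "i \<in> {1..K}" for i
    using that fun_cong[OF eq, of i] by (simp add: count_max_def)
  then show "cum_count cat B = cum_count cat B'"
    using cum_count_eqI assms by blast
next
  assume "cum_count cat B = cum_count cat B'"
  moreover have "count_max K \<eta> cat A \<in> extensional {1..K}" for A
    by (simp add: count_max_def)
  ultimately show "count_max K \<eta> cat B = count_max K \<eta> cat B'"
    using lex_less_total lex_less_count_max[OF assms] lex_less_count_max[OF assms(3,4,1,2)]
    by (metis order_refl)
qed

lemma cum_count_less_imp_lex_less_count_max:
  assumes "finite B" "cat ` B \<subseteq> \<eta> ` {1..K}" "finite B'" "cat ` B' \<subseteq> \<eta> ` {1..K}"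
    and "cum_count cat B < cum_count cat B'"
  shows "lex_less K (count_max K \<eta> cat B) (count_max K \<eta> cat B')"
proof -
  have "count_max K \<eta> cat B \<noteq> count_max K \<eta> cat B'"
    using count_max_eq_iff[OF assms(1-4)] assms(5) by auto
  moreover have "count_max K \<eta> cat A \<in> extensional {1..K}" for A
    by (simp add: count_max_def)
  ultimately show ?thesis
    using lex_less_total lex_less_count_max[OF assms(3,4,1,2)] assms(5) by (metis less_imp_le)
qed

lemma cum_count_less_imp_lex_less_count_min:
  assumes "finite B" "cat ` B \<subseteq> \<eta> ` {1..K}" "finite B'" "cat ` B' \<subseteq> \<eta> ` {1..K}"
    and "card B = card B'" "cum_count cat B < cum_count cat B'"
  shows "lex_less K (count_min K \<eta> cat B') (count_min K \<eta> cat B)"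
proof -
  have "count_min K \<eta> cat B \<noteq> count_min K \<eta> cat B'"
    using count_max_eq_iff[OF assms(1-4)] assms(6) by (auto simp: count_min_eq_iff_count_max)
  moreover have "count_min K \<eta> cat A \<in> extensional {1..K}" for A
    by (simp add: count_min_def)
  ultimately show ?thesis
    using lex_less_total lex_less_count_min[OF assms(3,4,1,2)] assms(5,6) by (metis less_imp_le)
qed

end

theorem theorem4:
  fixes E :: "'a set" and \<I> :: "'a set set"
    and K :: nat and \<eta> :: "nat \<Rightarrow> 'c::linorder" and cat :: "'a \<Rightarrow> 'c"
  assumes "matroid E \<I>"
    and "bases \<I> \<noteq> {}"
    and "strict_mono_on {1..K} \<eta>"
    and "cat \<in> E \<rightarrow> \<eta> ` {1..K}"
  shows "(\<forall>B\<in>bases \<I>.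
            (B \<in> MPO_efficient \<I> cat \<longleftrightarrow> B \<in> MPCmin_efficient \<I> K \<eta> cat) \<and>
            (B \<in> MPCmin_efficient \<I> K \<eta> cat \<longleftrightarrow> B \<in> MPCmax_efficient \<I> K \<eta> cat)) \<and>
         MPO_efficient \<I> cat = MPCmin_efficient \<I> K \<eta> cat \<and>
         MPCmin_efficient \<I> K \<eta> cat = MPCmax_efficient \<I> K \<eta> cat \<and>
         card (MPO_nondominated \<I> cat) = 1 \<and>
         card (MPCmin_nondominated \<I> K \<eta> cat) = 1 \<and>
         card (MPCmax_nondominated \<I> K \<eta> cat) = 1"
proof -
  interpret matroid E \<I>
    by fact
  let ?G = "{B \<in> bases \<I>. \<forall>B'\<in>bases \<I>. cum_count cat B' \<le> cum_count cat B}"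
  have fin: "finite B" and card: "card B = matroid_rank \<I>"
    and sub: "cat ` B \<subseteq> \<eta> ` {1..K}" if "B \<in> bases \<I>" for B
    using finite_basis[OF that] card_basis[OF that] indep_subset_ground[OF basis_indep[OF that]]
      assms(4) by auto
  have MPO: "MPO_efficient \<I> cat = ?G"
    unfolding MPO_efficient_def
    by (rule efficient_set_eq_greatest)
      (use fin card in \<open>auto simp: ordinally_dominates_iff less_le_not_le\<close>)
  have MPCmin: "MPCmin_efficient \<I> K \<eta> cat = ?G"
    unfolding MPCmin_efficient_def
    by (rule efficient_set_eq_greatest)
      (use fin sub card lex_less_count_min[OF assms(3)]
        cum_count_less_imp_lex_less_count_min[OF assms(3)] in metis)+
  have MPCmax: "MPCmax_efficient \<I> K \<eta> cat = ?G"
    unfolding MPCmax_efficient_def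
    by (rule efficient_set_eq_greatest)
      (use fin sub lex_less_count_max[OF assms(3)]
        cum_count_less_imp_lex_less_count_max[OF assms(3)] in metis)+
  have "card (MPO_nondominated \<I> cat) = 1"
    unfolding MPO_nondominated_def MPO
    by (rule card_image_greatest) (simp add: fin card ordinal_vec_eq_iff)
  moreover have "card (MPCmin_nondominated \<I> K \<eta> cat) = 1"
    unfolding MPCmin_nondominated_def MPCmin
    by (rule card_image_greatest)
      (use fin sub count_max_eq_iff[OF assms(3)] count_min_eq_iff_count_max in metis)
  moreover have "card (MPCmax_nondominated \<I> K \<eta> cat) = 1"
    unfolding MPCmax_nondominated_def MPCmax
    by (rule card_image_greatest) (use fin sub count_max_eq_iff[OF assms(3)] in metis)
  ultimately show ?thesis
    by (simp add: MPO MPCmin MPCmax)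
qed

end
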